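(* Let $d_x\ge0$, $d_v\ge1$, $D=d_x+d_v$, and let $A_v,B,c,\phi,U,\psi,G_h,\mathcal L,\mathcal L^*,W,W_+,W_{+,2m}$ be as in the context, with the Kalman rank condition there. Assume there exist $h_0>0$, $C>0$ and an integer $m\ge0$ such that, for every $0<h\le h_0$, $$0<(G_h\psi)(y)<\infty\ \text{ for every }y\in\mathbb R^D,\qquad\left\|\frac{G_h\psi}{\psi}\right\|_{L_W^\infty}+\left\|\frac{\psi}{G_h\psi}\right\|_{L_W^\infty}\le C,$$ $$\left\|\frac{G_h(\psi f)}{G_h\psi}-f-h\mathcal Lf\right\|_{L^\infty_{W_{+,2m}}}\le Ch^2\|f\|_{C_W^4},\qquad f\in C_W^4(\mathbb R^D),$$ where it is understood that for every $f\in C_W^4(\mathbb R^D)$, every $0<h\le h_0$ and every probability density $\rho$ with $m_{W_{+,2m}}(\rho)<\infty$, the functions $\frac{G_h(\psi|f|)}{G_h\psi}\rho$ and $(\mathcal Lf)\rho$ are integrable. Let $$(\mathcal K_h^{\mathrm{aff}}\rho)(z):=\psi(z)\int_{\mathbb R^D}G_h(z\mid y)\frac{\rho(y)}{(G_h\psi)(y)}\,dy.$$ (a) For every $T>0$ there exist $h_T\in(0,\min\{h_0,T\}]$ and $C_T>0$ such that, for every $f\in C_W^4(\mathbb R^D)$, every probability density $\rho$ on $\mathbb R^D$ with $m_{W_{+,2m}}(\rho)<\infty$, and every $0<h\le h_T$, $$\left|\int_{\mathbb R^D}\left[f\,\mathcal K_h^{\mathrm{aff}}\rho-f\rho-h(\mathcal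 Lf)\rho\right]dz\right|\le C_Th^2\|f\|_{C_W^4}\,m_{W_{+,2m}}(\rho).$$ (b) Fix $T>0$. Let $\rho(t)$ (a probability density for each $t$) solve $\partial_t\rho=\mathcal L^*\rho$ with $\rho(0)=\rho_0$, and define $\rho_0^h=\rho_0$, $\rho_{k+1}^h=\mathcal K_h^{\mathrm{aff}}\rho_k^h$. Suppose that: (i) there is a constant $C_T^{(1)}$ such that for every $f\in C_W^4(\mathbb R^D)$ the backward equation $\partial_tu=\mathcal Lu$, $u(0)=f$, has a classical solution on $[0,T]\times\mathbb R^D$ (for which $\partial_{tt}u$ exists) with $\sup_{0\le t\le T}\|u(t)\|_{C_W^4}+\sup_{0\le t\le T}\|\partial_{tt}u(t)\|_{L^\infty_{W_{+,2m}}}\le C_T^{(1)}\|f\|_{C_W^4}$; (ii) $\int_{\mathbb R^D}f\rho(t)\,dz=\int_{\mathbb R^D}u(t)\rho_0\,dz$ for $0\le t\le T$; (iii) there exist $h_T'\in(0,\min\{h_0,1\}]$ and $M_T>0$ with $\sup_{0\le t\le T}m_{W_{+,2m}}(\rho(t))+\sup_{h\in(0,h_T']}\sup_{k:\,kh\le T}m_{W_{+,2m}}(\rho_k^h)\le M_T$. Then, possibly after decreasing $h_T$ and enlarging $C_T$, for every $f\in C_W^4(\mathbb R^D)$, every $0<h\le h_T$ and every integer $n\ge0$ with $nh\le T$, $$\left|\int_{\mathbb R^D}f\rho_n^h\,dz-\int_{\mathbb R^D}f\rho(nh)\,dz\right|\le C_Th\|f\|_{C_W^4}.$$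
   Context: Let $z=(x,v)\in\mathbb R^{d_x}\times\mathbb R^{d_v}$, $D:=d_x+d_v$; $d_x=0$ is allowed, in which case $z=v\in\mathbb R^{d_v}$. $A_v\in\mathbb R^{d_v\times d_v}$ is constant, symmetric, positive definite; $b(z)=Bz+c$ with $B\in\mathbb R^{D\times D}$, $c\in\mathbb R^D$; $\phi:\mathbb R^D\to\mathbb R$ is a sufficiently regular potential (so that the expressions below make sense and the assumed estimates hold), $U(z):=A_v\nabla_v\phi(z)$, $\psi:=e^{-\phi/2}$. Operators: $D_0f:=b\cdot\nabla_zf+\nabla_v\cdot(A_v\nabla_vf)$, $D_0^*\rho:=-\nabla_z\cdot(b\rho)+\nabla_v\cdot(A_v\nabla_v\rho)$, $\mathcal Lf:=D_0f-U\cdot\nabla_vf$, $\mathcal L^*\rho:=D_0^*\rho+\nabla_v\cdot(U\rho)$. Set $\mathcal A:=\operatorname{diag}(0,A_v)\in\mathbb R^{D\times D}$ (zero block omitted if $d_x=0$), $m_h:=\int_0^he^{(h-s)B}c\,ds$, $Q_h:=2\int_0^he^{(h-s)B}\mathcal Ae^{(h-s)B^\top}ds$. Assume $Q_h$ is positive definite for $h>0$, equivalently the Kalman rank condition $\operatorname{rank}[\mathcal A^{1/2},B\mathcal A^{1/2},\dots,B^{D-1}\mathcal A^{1/2}]=D$. Define $$G_h(z\mid y)=\frac{1}{(2\pi)^{D/2}(\det Q_h)^{1/2}}\exp\!\left(-\tfrac12(z-e^{hB}y-m_h)^\top Q_h^{-1}(z-e^{hB}y-m_h)\right),$$ and $(G_hg)(y):=\int_{\mathbb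 R^D}G_h(z\mid y)g(z)\,dz$. Weights: for fixed $0<\theta<\bar\theta$, $W(z):=\exp(\theta(1+|x|^2+|v|^2))$, $W_+(z):=\exp(\bar\theta(1+|x|^2+|v|^2))$, $W_{+,2m}(z):=(1+|x|+|v|)^{2m}W(z)^2W_+(z)$. For a weight $\omega\ge1$: $\|g\|_{L^\infty_\omega}:=\sup_z|g(z)|/\omega(z)$; $C_\omega^k(\mathbb R^D):=\{f\in C^k:\|f\|_{C_\omega^k}:=\sum_{|\alpha|\le k}\|\partial^\alpha f\|_{L^\infty_\omega}<\infty\}$; $m_\omega(\rho):=\int_{\mathbb R^D}\omega\rho\,dz$. *)

theory Defs
  imports "HOL-Analysis.Analysis"
begin

text \<open>
  The phase space is \<open>real ^ 'n\<close>, so \<open>D = CARD('n)\<close>.  The velocity coordinates are singled out by an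
  injection \<open>\<iota> :: 'v \<Rightarrow> 'n\<close>, i.e. \<open>v\<^sub>j\<close> is the coordinate \<open>z $ \<iota> j\<close>, \<open>d\<^sub>v = CARD('v) \<ge> 1\<close>, and the
  coordinates outside \<open>range \<iota>\<close> form \<open>x\<close>, so \<open>d\<^sub>x = CARD('n) - CARD('v)\<close>.
  This covers \<open>d\<^sub>x = 0\<close> (\<open>\<iota>\<close> bijective), which an index type \<open>'x + 'v\<close> could not, types being nonempty.
\<close>

definition v_part :: "('v::finite \<Rightarrow> 'n::finite) \<Rightarrow> real^'n \<Rightarrow> real^'v" where
  "v_part \<iota> z = (\<chi> j. z $ \<iota> j)"

text \<open>The position part is padded with zeros in the velocity slots; this does not change its norm.\<close>

definition x_part :: "('v::finite \<Rightarrow> 'n::finite) \<Rightarrow> real^'n \<Rightarrow> real^'n" where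
  "x_part \<iota> z = (\<chi> i. if i \<in> range \<iota> then 0 else z $ i)"


subsection \<open>Partial derivatives and weighted spaces\<close>

definition has_partial :: "'n::finite \<Rightarrow> (real^'n \<Rightarrow> real) \<Rightarrow> real^'n \<Rightarrow> bool" where
  "has_partial i f z \<longleftrightarrow> (\<lambda>s::real. f (z + s *\<^sub>R axis i 1)) differentiable (at 0)"

definition partial :: "'n::finite \<Rightarrow> (real^'n \<Rightarrow> real) \<Rightarrow> real^'n \<Rightarrow> real" where
  "partial i f z = deriv (\<lambda>s::real. f (z + s *\<^sub>R axis i 1)) 0"

fun C_k :: "nat \<Rightarrow> (real^'n::finite \<Rightarrow> real) \<Rightarrow> bool" where
  "C_k 0 f \<longleftrightarrow> continuous_on UNIV f"
| "C_k (Suc k) f \<longleftrightarrow> continuous_on UNIV f \<and>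
     (\<forall>i. (\<forall>z. has_partial i f z) \<and> C_k k (partial i f))"

text \<open>
  A multi-index is a function \<open>\<alpha> :: 'n \<Rightarrow> nat\<close>.  Since \<open>'n\<close> carries no order, the order in which the
  partial derivatives are taken is an arbitrary choice; it is irrelevant for functions of class
  \<open>C\<^sup>k\<close> with \<open>k \<ge> \<bar>\<alpha>\<bar>\<close> by Schwarz's theorem.
\<close>

definition multi_partial :: "('n::finite \<Rightarrow> nat) \<Rightarrow> (real^'n \<Rightarrow> real) \<Rightarrow> real^'n \<Rightarrow> real" where
  "multi_partial \<alpha> f = foldr partial (SOME is. \<forall>i. count_list is i = \<alpha> i) f"

text \<open>The norms take values in \<open>[0, \<infinity>]\<close>, so that an infinite supremum is really \<open>\<infinity>\<close>.\<close>

definition Linf_norm :: "(real^'n::finite \<Rightarrow> real) \<Rightarrow> (real^'n \<Rightarrow> real) \<Rightarrow> ennreal" where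
  "Linf_norm \<omega> g = (SUP z. ennreal (\<bar>g z\<bar> / \<omega> z))"

definition Ck_norm :: "nat \<Rightarrow> (real^'n::finite \<Rightarrow> real) \<Rightarrow> (real^'n \<Rightarrow> real) \<Rightarrow> ennreal" where
  "Ck_norm k \<omega> f = (\<Sum>\<alpha> | (\<Sum>i\<in>UNIV. \<alpha> i) \<le> k. Linf_norm \<omega> (multi_partial \<alpha> f))"

definition Ck_space :: "nat \<Rightarrow> (real^'n::finite \<Rightarrow> real) \<Rightarrow> (real^'n \<Rightarrow> real) set" where
  "Ck_space k \<omega> = {f. C_k k f \<and> Ck_norm k \<omega> f < \<infinity>}"

definition prob_density :: "(real^'n::finite \<Rightarrow> real) \<Rightarrow> bool" where
  "prob_density \<rho> \<longleftrightarrow>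
     \<rho> \<in> borel_measurable borel \<and> (\<forall>z. 0 \<le> \<rho> z) \<and> (\<integral>\<^sup>+ z. ennreal (\<rho> z) \<partial>lborel) = 1"

definition moment :: "(real^'n::finite \<Rightarrow> real) \<Rightarrow> (real^'n \<Rightarrow> real) \<Rightarrow> ennreal" where
  "moment \<omega> \<rho> = (\<integral>\<^sup>+ z. ennreal (\<omega> z * \<rho> z) \<partial>lborel)"

definition weight :: "('v::finite \<Rightarrow> 'n::finite) \<Rightarrow> real \<Rightarrow> real^'n \<Rightarrow> real" where
  "weight \<iota> \<theta> z = exp (\<theta> * (1 + (norm (x_part \<iota> z))\<^sup>2 + (norm (v_part \<iota> z))\<^sup>2))"

definition weight_plus :: "('v::finite \<Rightarrow> 'n::finite) \<Rightarrow> real \<Rightarrow> real \<Rightarrow> nat \<Rightarrow> real^'n \<Rightarrow> real" where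
  "weight_plus \<iota> \<theta> \<theta>' m z =
     (1 + norm (x_part \<iota> z) + norm (v_part \<iota> z)) ^ (2 * m) * (weight \<iota> \<theta> z)\<^sup>2 * weight \<iota> \<theta>' z"


subsection \<open>Differential operators\<close>

definition grad :: "(real^'n::finite \<Rightarrow> real) \<Rightarrow> real^'n \<Rightarrow> real^'n" where
  "grad f z = (\<chi> i. partial i f z)"

definition grad_v :: "('v::finite \<Rightarrow> 'n::finite) \<Rightarrow> (real^'n \<Rightarrow> real) \<Rightarrow> real^'n \<Rightarrow> real^'v" where
  "grad_v \<iota> f z = (\<chi> j. partial (\<iota> j) f z)"

definition divergence :: "(real^'n::finite \<Rightarrow> real^'n) \<Rightarrow> real^'n \<Rightarrow> real" where
  "divergence F z = (\<Sum>i\<in>UNIV. partial i (\<lambda>w. F w $ i) z)"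

definition div_v :: "('v::finite \<Rightarrow> 'n::finite) \<Rightarrow> (real^'n \<Rightarrow> real^'v) \<Rightarrow> real^'n \<Rightarrow> real" where
  "div_v \<iota> F z = (\<Sum>j\<in>UNIV. partial (\<iota> j) (\<lambda>w. F w $ j) z)"

definition drift :: "real^'n^'n \<Rightarrow> real^'n \<Rightarrow> real^'n::finite \<Rightarrow> real^'n" where
  "drift B c z = B *v z + c"

definition U_field ::
  "('v::finite \<Rightarrow> 'n::finite) \<Rightarrow> real^'v^'v \<Rightarrow> (real^'n \<Rightarrow> real) \<Rightarrow> real^'n \<Rightarrow> real^'v" where
  "U_field \<iota> A \<phi> z = A *v grad_v \<iota> \<phi> z"

definition D0 :: "('v::finite \<Rightarrow> 'n::finite) \<Rightarrow> real^'v^'v \<Rightarrow> real^'n^'n \<Rightarrow> real^'n \<Rightarrow>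
    (real^'n \<Rightarrow> real) \<Rightarrow> real^'n \<Rightarrow> real" where
  "D0 \<iota> A B c f z = drift B c z \<bullet> grad f z + div_v \<iota> (\<lambda>w. A *v grad_v \<iota> f w) z"

definition D0_adj :: "('v::finite \<Rightarrow> 'n::finite) \<Rightarrow> real^'v^'v \<Rightarrow> real^'n^'n \<Rightarrow> real^'n \<Rightarrow>
    (real^'n \<Rightarrow> real) \<Rightarrow> real^'n \<Rightarrow> real" where
  "D0_adj \<iota> A B c \<rho> z =
     - divergence (\<lambda>w. \<rho> w *\<^sub>R drift B c w) z + div_v \<iota> (\<lambda>w. A *v grad_v \<iota> \<rho> w) z"

definition L_op :: "('v::finite \<Rightarrow> 'n::finite) \<Rightarrow> real^'v^'v \<Rightarrow> real^'n^'n \<Rightarrow> real^'n \<Rightarrow>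
    (real^'n \<Rightarrow> real) \<Rightarrow> (real^'n \<Rightarrow> real) \<Rightarrow> real^'n \<Rightarrow> real" where
  "L_op \<iota> A B c \<phi> f z = D0 \<iota> A B c f z - U_field \<iota> A \<phi> z \<bullet> grad_v \<iota> f z"

definition L_adj :: "('v::finite \<Rightarrow> 'n::finite) \<Rightarrow> real^'v^'v \<Rightarrow> real^'n^'n \<Rightarrow> real^'n \<Rightarrow>
    (real^'n \<Rightarrow> real) \<Rightarrow> (real^'n \<Rightarrow> real) \<Rightarrow> real^'n \<Rightarrow> real" where
  "L_adj \<iota> A B c \<phi> \<rho> z = D0_adj \<iota> A B c \<rho> z + div_v \<iota> (\<lambda>w. \<rho> w *\<^sub>R U_field \<iota> A \<phi> w) z"


subsection \<open>Matrices and the Gaussian kernel\<close>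

definition pos_semidef :: "real^'n^'n::finite \<Rightarrow> bool" where
  "pos_semidef M \<longleftrightarrow> transpose M = M \<and> (\<forall>x. 0 \<le> x \<bullet> (M *v x))"

definition pos_def :: "real^'n^'n::finite \<Rightarrow> bool" where
  "pos_def M \<longleftrightarrow> transpose M = M \<and> (\<forall>x. x \<noteq> 0 \<longrightarrow> 0 < x \<bullet> (M *v x))"

text \<open>Well defined for positive semidefinite \<open>M\<close>.\<close>

definition mat_sqrt :: "real^'n^'n \<Rightarrow> real^'n^'n::finite" where
  "mat_sqrt M = (THE R. pos_semidef R \<and> R ** R = M)"

definition mat_pow :: "real^'n^'n \<Rightarrow> nat \<Rightarrow> real^'n^'n::finite" where
  "mat_pow M k = (((**) M) ^^ k) (mat 1)"

text \<open>The instance of \<open>times\<close> for vectors is componentwise, hence \<open>exp\<close> is not the matrix exponential.\<close>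

definition mat_exp :: "real^'n^'n \<Rightarrow> real^'n^'n::finite" where
  "mat_exp M = (\<Sum>k. (1 / fact k) *\<^sub>R mat_pow M k)"

definition diag_zero :: "('v::finite \<Rightarrow> 'n::finite) \<Rightarrow> real^'v^'v \<Rightarrow> real^'n^'n" where
  "diag_zero \<iota> A =
     (\<chi> i j. if i \<in> range \<iota> \<and> j \<in> range \<iota> then A $ inv \<iota> i $ inv \<iota> j else 0)"

text \<open>
  The rank of the block matrix \<open>[M\<^sup>1\<^sup>/\<^sup>2, B M\<^sup>1\<^sup>/\<^sup>2, \<dots>, B\<^sup>D\<^sup>-\<^sup>1 M\<^sup>1\<^sup>/\<^sup>2]\<close> is the dimension of the span of
  the columns of all its blocks.
\<close>

definition kalman_rank_condition :: "real^'n^'n \<Rightarrow> real^'n^'n::finite \<Rightarrow> bool" where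
  "kalman_rank_condition M B \<longleftrightarrow>
     dim (\<Union>k<CARD('n). columns (mat_pow B k ** mat_sqrt M)) = CARD('n)"

definition m_vec :: "real^'n^'n \<Rightarrow> real^'n \<Rightarrow> real \<Rightarrow> real^'n::finite" where
  "m_vec B c h = integral {0..h} (\<lambda>s. mat_exp ((h - s) *\<^sub>R B) *v c)"

definition Q_mat :: "real^'n^'n \<Rightarrow> real^'n^'n \<Rightarrow> real \<Rightarrow> real^'n^'n::finite" where
  "Q_mat M B h = 2 *\<^sub>R integral {0..h}
     (\<lambda>s. mat_exp ((h - s) *\<^sub>R B) ** M ** mat_exp ((h - s) *\<^sub>R transpose B))"

definition G_kernel :: "real^'n^'n \<Rightarrow> real^'n^'n \<Rightarrow> real^'n \<Rightarrow> real \<Rightarrow>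
    real^'n::finite \<Rightarrow> real^'n \<Rightarrow> real" where
  "G_kernel M B c h z y =
     (let w = z - mat_exp (h *\<^sub>R B) *v y - m_vec B c h
      in 1 / ((2 * pi) powr (CARD('n) / 2) * sqrt (det (Q_mat M B h))) *
         exp (- (w \<bullet> (matrix_inv (Q_mat M B h) *v w)) / 2))"

definition G_op :: "real^'n^'n \<Rightarrow> real^'n^'n \<Rightarrow> real^'n \<Rightarrow> real \<Rightarrow>
    (real^'n::finite \<Rightarrow> real) \<Rightarrow> real^'n \<Rightarrow> real" where
  "G_op M B c h g y = (\<integral> z. G_kernel M B c h z y * g z \<partial>lborel)"

text \<open>
  The same operator on nonnegative functions, with values in \<open>[0, \<infinity>]\<close>.  It is needed wherever finiteness
  matters, because the Bochner integral of a non-integrable function is \<open>0\<close>.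
\<close>

definition G_op_nn :: "real^'n^'n \<Rightarrow> real^'n^'n \<Rightarrow> real^'n \<Rightarrow> real \<Rightarrow>
    (real^'n::finite \<Rightarrow> real) \<Rightarrow> real^'n \<Rightarrow> ennreal" where
  "G_op_nn M B c h g y = (\<integral>\<^sup>+ z. ennreal (G_kernel M B c h z y * g z) \<partial>lborel)"

definition psi :: "(real^'n::finite \<Rightarrow> real) \<Rightarrow> real^'n \<Rightarrow> real" where
  "psi \<phi> z = exp (- \<phi> z / 2)"

definition K_aff :: "real^'n^'n \<Rightarrow> real^'n^'n \<Rightarrow> real^'n \<Rightarrow> (real^'n::finite \<Rightarrow> real) \<Rightarrow> real \<Rightarrow>
    (real^'n \<Rightarrow> real) \<Rightarrow> real^'n \<Rightarrow> real" where
  "K_aff M B c \<phi> h \<rho> z =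
     psi \<phi> z * (\<integral> y. G_kernel M B c h z y * (\<rho> y / G_op M B c h (psi \<phi>) y) \<partial>lborel)"


subsection \<open>Evolution equations\<close>

text \<open>Time derivative on \<open>[0, T]\<close>, one-sided at the end points.\<close>

definition time_deriv :: "real \<Rightarrow> (real \<Rightarrow> real^'n::finite \<Rightarrow> real) \<Rightarrow> real \<Rightarrow> real^'n \<Rightarrow> real" where
  "time_deriv T u t z = vector_derivative (\<lambda>s. u s z) (at t within {0..T})"

definition time_differentiable :: "real \<Rightarrow> (real \<Rightarrow> real^'n::finite \<Rightarrow> real) \<Rightarrow> bool" where
  "time_differentiable T u \<longleftrightarrow>
     (\<forall>t\<in>{0..T}. \<forall>z. (\<lambda>s. u s z) differentiable (at t within {0..T}))"

text \<open>
  Classical solution on \<open>[0, T] \<times> \<real>\<^sup>D\<close>, twice differentiable in time.  The spatial regularity \<open>C\<^sup>4\<close> is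
  the one presupposed by the bound on the \<open>C\<^sup>4\<close>-norm of \<open>u(t)\<close> in which the notion is used.
\<close>

definition backward_solution :: "('v::finite \<Rightarrow> 'n::finite) \<Rightarrow> real^'v^'v \<Rightarrow> real^'n^'n \<Rightarrow> real^'n \<Rightarrow>
    (real^'n \<Rightarrow> real) \<Rightarrow> real \<Rightarrow> (real^'n \<Rightarrow> real) \<Rightarrow> (real \<Rightarrow> real^'n \<Rightarrow> real) \<Rightarrow> bool" where
  "backward_solution \<iota> A B c \<phi> T f u \<longleftrightarrow>
     u 0 = f \<and> (\<forall>t\<in>{0..T}. C_k 4 (u t)) \<and>
     time_differentiable T u \<and> time_differentiable T (time_deriv T u) \<and>
     (\<forall>t\<in>{0..T}. \<forall>z. time_deriv T u t z = L_op \<iota> A B c \<phi> (u t) z)"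

text \<open>
  For the forward equation both classical and weak solutions are admitted.  A classical solution
  satisfies the equation pointwise for \<open>0 < t \<le> T\<close> (no smoothness of the initial density is imposed).
\<close>

definition forward_classical :: "('v::finite \<Rightarrow> 'n::finite) \<Rightarrow> real^'v^'v \<Rightarrow> real^'n^'n \<Rightarrow> real^'n \<Rightarrow>
    (real^'n \<Rightarrow> real) \<Rightarrow> real \<Rightarrow> (real \<Rightarrow> real^'n \<Rightarrow> real) \<Rightarrow> bool" where
  "forward_classical \<iota> A B c \<phi> T \<rho> \<longleftrightarrow>
     (\<forall>t\<in>{0<..T}. \<forall>z.
        (\<forall>i. has_partial i (\<rho> t) z) \<and>
        (\<forall>j k. has_partial (\<iota> j) (partial (\<iota> k) (\<rho> t)) z) \<and>
        (\<forall>j. has_partial (\<iota> j) (\<lambda>w. (\<rho> t w *\<^sub>R U_field \<iota> A \<phi> w) $ j) z) \<and>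
        ((\<lambda>s. \<rho> s z) has_real_derivative L_adj \<iota> A B c \<phi> (\<rho> t) z) (at t within {0..T}))"

text \<open>
  In the weak formulation \<open>L_adj\<close> is moved onto smooth compactly supported test functions, where it
  becomes \<open>L_op\<close>, and the equation is integrated in time.
\<close>

definition test_function :: "(real^'n::finite \<Rightarrow> real) \<Rightarrow> bool" where
  "test_function \<eta> \<longleftrightarrow> (\<forall>k. C_k k \<eta>) \<and> bounded {z. \<eta> z \<noteq> 0}"

definition forward_weak :: "('v::finite \<Rightarrow> 'n::finite) \<Rightarrow> real^'v^'v \<Rightarrow> real^'n^'n \<Rightarrow> real^'n \<Rightarrow>
    (real^'n \<Rightarrow> real) \<Rightarrow> real \<Rightarrow> (real \<Rightarrow> real^'n \<Rightarrow> real) \<Rightarrow> bool" where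
  "forward_weak \<iota> A B c \<phi> T \<rho> \<longleftrightarrow>
     (\<forall>\<eta>. test_function \<eta> \<longrightarrow> (\<forall>t\<in>{0..T}.
        set_integrable lborel {0..t} (\<lambda>s. \<integral> z. L_op \<iota> A B c \<phi> \<eta> z * \<rho> s z \<partial>lborel) \<and>
        (\<integral> z. \<eta> z * \<rho> t z \<partial>lborel) = (\<integral> z. \<eta> z * \<rho> 0 z \<partial>lborel) +
          (LINT s:{0..t}|lborel. (\<integral> z. L_op \<iota> A B c \<phi> \<eta> z * \<rho> s z \<partial>lborel))))"

definition forward_solution :: "('v::finite \<Rightarrow> 'n::finite) \<Rightarrow> real^'v^'v \<Rightarrow> real^'n^'n \<Rightarrow> real^'n \<Rightarrow>
    (real^'n \<Rightarrow> real) \<Rightarrow> real \<Rightarrow> (real \<Rightarrow> real^'n \<Rightarrow> real) \<Rightarrow> bool" where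
  "forward_solution \<iota> A B c \<phi> T \<rho> \<longleftrightarrow>
     forward_classical \<iota> A B c \<phi> T \<rho> \<or> forward_weak \<iota> A B c \<phi> T \<rho>"


subsection \<open>The two error estimates\<close>

text \<open>Here \<open>L\<close>, \<open>K\<close>, \<open>W\<close>, \<open>W2\<close> stand for the generator, the one-step map and the two weights.\<close>

definition one_step_bound where
  "one_step_bound L K W W2 h\<^sub>T C\<^sub>T \<longleftrightarrow>
     (\<forall>f\<in>Ck_space 4 W. \<forall>\<rho>. prob_density \<rho> \<and> moment W2 \<rho> < \<infinity> \<longrightarrow> (\<forall>h\<in>{0<..h\<^sub>T}.
        ennreal \<bar>\<integral> z. f z * K h \<rho> z - f z * \<rho> z - h * (L f z * \<rho> z) \<partial>lborel\<bar>
          \<le> ennreal (C\<^sub>T * h\<^sup>2) * Ck_norm 4 W f * moment W2 \<rho>))"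
  for L :: "(real^'n::finite \<Rightarrow> real) \<Rightarrow> real^'n \<Rightarrow> real"
    and K :: "real \<Rightarrow> (real^'n \<Rightarrow> real) \<Rightarrow> real^'n \<Rightarrow> real"
    and W W2 :: "real^'n \<Rightarrow> real" and h\<^sub>T C\<^sub>T :: real

definition global_bound where
  "global_bound K W T \<rho> h\<^sub>T C\<^sub>T \<longleftrightarrow>
     (\<forall>f\<in>Ck_space 4 W. \<forall>h\<in>{0<..h\<^sub>T}. \<forall>n. real n * h \<le> T \<longrightarrow>
        ennreal \<bar>(\<integral> z. f z * (K h ^^ n) (\<rho> 0) z \<partial>lborel) - (\<integral> z. f z * \<rho> (real n * h) z \<partial>lborel)\<bar>
          \<le> ennreal (C\<^sub>T * h) * Ck_norm 4 W f)"
  for K :: "real \<Rightarrow> (real^'n::finite \<Rightarrow> real) \<Rightarrow> real^'n \<Rightarrow> real"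
    and W :: "real^'n \<Rightarrow> real" and \<rho> :: "real \<Rightarrow> real^'n \<Rightarrow> real" and T h\<^sub>T C\<^sub>T :: real

end

theory Submission
  imports Defs
begin

text \<open>
  The one-step map is the dual of the Markov operator \<open>f \<mapsto> G\<^sub>h(\<psi>f) / G\<^sub>h\<psi>\<close>, so by Fubini's theorem the
  weak one-step error against \<open>\<rho>\<close> is the integral against \<open>\<rho>\<close> of the strong consistency error of that
  operator.  For the global error, the solution \<open>u\<close> of the backward equation turns
  \<open>\<integral> f \<rho>\<^sub>n\<^sup>h - \<integral> f \<rho>(nh)\<close> into the telescoping sum over \<open>k\<close> of
  \<open>\<integral> u(t\<^sub>n\<^sub>-\<^sub>k\<^sub>-\<^sub>1) \<rho>\<^sub>k\<^sub>+\<^sub>1\<^sup>h - \<integral> u(t\<^sub>n\<^sub>-\<^sub>k) \<rho>\<^sub>k\<^sup>h\<close>.  The one-step estimate and Taylor's formula in time both replace the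
  two terms, up to \<open>O(h\<^sup>2)\<close>, by \<open>\<integral> (u + h L u) \<rho>\<^sub>k\<^sup>h\<close> with \<open>u\<close> taken at \<open>t\<^sub>n\<^sub>-\<^sub>k\<^sub>-\<^sub>1\<close>.
\<close>

section \<open>Markov kernels acting on densities\<close>

text \<open>Tonelli's theorem carries the mass of \<open>\<rho>\<close> over. The inner extended
  integral may be infinite on a null set of \<open>z\<close>; there the Bochner integral is 0 by
  default, which affects neither sign nor mass.\<close>

lemma kernel_prob_density:
  fixes k :: "real^'n::finite \<Rightarrow> real^'n \<Rightarrow> real"
  assumes [measurable]: "case_prod k \<in> borel_measurable (borel \<Otimes>\<^sub>M borel)"
    and nonneg: "\<And>z y. 0 \<le> k z y"
    and mass: "\<And>y. (\<integral>\<^sup>+ z. ennreal (k z y) \<partial>lborel) = 1"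
    and \<rho>: "prob_density \<rho>"
  shows "prob_density (\<lambda>z. \<integral> y. k z y * \<rho> y \<partial>lborel)"
proof -
  have [measurable]: "\<rho> \<in> borel_measurable borel" and \<rho>0: "\<And>z. 0 \<le> \<rho> z"
    and \<rho>1: "(\<integral>\<^sup>+ z. ennreal (\<rho> z) \<partial>lborel) = 1"
    using \<rho> by (auto simp: prob_density_def)
  have "(\<integral>\<^sup>+ z. (\<integral>\<^sup>+ y. ennreal (k z y * \<rho> y) \<partial>lborel) \<partial>lborel)
      = (\<integral>\<^sup>+ y. (\<integral>\<^sup>+ z. ennreal (k z y * \<rho> y) \<partial>lborel) \<partial>lborel)"
    by (rule lborel_pair.Fubini') simp
  also have "\<dots> = (\<integral>\<^sup>+ y. ennreal (\<rho> y) \<partial>lborel)"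
    using nonneg \<rho>0 by (simp add: ennreal_mult nn_integral_multc mass)
  finally have total: "(\<integral>\<^sup>+ z. (\<integral>\<^sup>+ y. ennreal (k z y * \<rho> y) \<partial>lborel) \<partial>lborel) = 1"
    using \<rho>1 by simp
  have "AE z in lborel. (\<integral>\<^sup>+ y. ennreal (k z y * \<rho> y) \<partial>lborel) \<noteq> \<infinity>"
    by (rule nn_integral_PInf_AE) (use total in auto)
  then have ae: "AE z in lborel. ennreal (\<integral> y. k z y * \<rho> y \<partial>lborel)
      = (\<integral>\<^sup>+ y. ennreal (k z y * \<rho> y) \<partial>lborel)"
  proof eventually_elim
    case (elim z)
    have "integrable lborel (\<lambda>y. k z y * \<rho> y)"
      using elim nonneg \<rho>0 by (intro integrableI_nonneg) (auto simp: less_top)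
    then show ?case
      using nonneg \<rho>0 by (intro nn_integral_eq_integral[symmetric]) auto
  qed
  have "(\<integral>\<^sup>+ z. ennreal (\<integral> y. k z y * \<rho> y \<partial>lborel) \<partial>lborel) = 1"
    using nn_integral_cong_AE[OF ae] total by simp
  then show ?thesis
    using nonneg \<rho>0 by (auto simp: prob_density_def intro!: integral_nonneg_AE)
qed

text \<open>Fubini's theorem, with \<open>fin\<close> expressing absolute integrability on the
  product space. Both integrability claims are recorded because integrals of sums are split
  later.\<close>

lemma kernel_adjoint:
  fixes k :: "real^'n::finite \<Rightarrow> real^'n \<Rightarrow> real"
  assumes [measurable]: "case_prod k \<in> borel_measurable (borel \<Otimes>\<^sub>M borel)"
      "f \<in> borel_measurable borel" "\<rho> \<in> borel_measurable borel"
    and nonneg: "\<And>z y. 0 \<le> k z y" "\<And>y. 0 \<le> \<rho> y"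
    and fin: "(\<integral>\<^sup>+ y. (\<integral>\<^sup>+ z. ennreal (k z y * \<bar>f z\<bar>) \<partial>lborel) * ennreal (\<rho> y) \<partial>lborel) < \<infinity>"
  shows "integrable lborel (\<lambda>z. f z * (\<integral> y. k z y * \<rho> y \<partial>lborel))" (is ?I1)
    and "integrable lborel (\<lambda>y. (\<integral> z. k z y * f z \<partial>lborel) * \<rho> y)" (is ?I2)
    and "(\<integral> z. f z * (\<integral> y. k z y * \<rho> y \<partial>lborel) \<partial>lborel)
       = (\<integral> y. (\<integral> z. k z y * f z \<partial>lborel) * \<rho> y \<partial>lborel)" (is ?E)
proof -
  define F where "F z y = f z * (k z y * \<rho> y)" for z y
  have [measurable]: "case_prod F \<in> borel_measurable (borel \<Otimes>\<^sub>M borel)"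
    unfolding F_def by measurable
  have "(\<integral>\<^sup>+ p. ennreal (norm (case_prod F p)) \<partial>(lborel \<Otimes>\<^sub>M lborel))
      = (\<integral>\<^sup>+ y. (\<integral>\<^sup>+ z. ennreal (norm (F z y)) \<partial>lborel) \<partial>lborel)"
    by (subst lborel_pair.nn_integral_snd[symmetric]) (auto simp: case_prod_beta)
  also have "\<dots> = (\<integral>\<^sup>+ y. (\<integral>\<^sup>+ z. ennreal (k z y * \<bar>f z\<bar>) \<partial>lborel) * ennreal (\<rho> y) \<partial>lborel)"
    using nonneg
    by (intro nn_integral_cong, subst nn_integral_multc[symmetric])
       (auto simp: F_def abs_mult ennreal_mult'[symmetric] mult_ac intro!: nn_integral_cong)
  finally have int: "integrable (lborel \<Otimes>\<^sub>M lborel) (case_prod F)"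
    using fin by (intro integrableI_bounded) auto
  have 1: "(\<integral> y. F z y \<partial>lborel) = f z * (\<integral> y. k z y * \<rho> y \<partial>lborel)" for z
    by (simp add: F_def)
  have 2: "(\<integral> z. F z y \<partial>lborel) = (\<integral> z. k z y * f z \<partial>lborel) * \<rho> y" for y
  proof -
    have "(\<integral> z. F z y \<partial>lborel) = (\<integral> z. (k z y * f z) * \<rho> y \<partial>lborel)"
      by (simp add: F_def mult_ac)
    then show ?thesis by simp
  qed
  show ?I1 using lborel_pair.integrable_fst'[OF int] by (simp add: 1)
  show ?I2 using lborel_pair.integrable_snd[OF int] by (simp add: 2)
  show ?E using lborel_pair.Fubini_integral[OF int] by (simp add: 1 2)
qed

section \<open>The Gaussian kernel: measurability and sign\<close>

text \<open>For fixed \<open>h\<close> all matrices in the formula are constants, so the kernel is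
  continuous in the pair of its arguments.\<close>

lemma G_kernel_measurable [measurable]:
  "(\<lambda>(z, y). G_kernel M B c h z y) \<in> borel_measurable (borel \<Otimes>\<^sub>M borel)"
proof -
  have "continuous_on UNIV (\<lambda>p. G_kernel M B c h (fst p) (snd p))"
    unfolding G_kernel_def Let_def
    by (intro continuous_intros linear_continuous_on_compose[OF _ matrix_vector_mul_linear]) auto
  then show ?thesis
    by (simp add: borel_prod case_prod_beta borel_measurable_continuous_onI)
qed

text \<open>
  \<open>sqrt\<close> is odd, so the kernel has the sign of \<open>det Q\<close>; a positive value of the integral excludes the
  negative sign.
\<close>

lemma G_kernel_nonneg:
  assumes "0 < G_op_nn M B c h g y" and "\<And>z. 0 \<le> g z"
  shows "0 \<le> G_kernel M B c h z y'"
proof -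
  have "0 \<le> det (Q_mat M B h)"
  proof (rule ccontr)
    assume "\<not> 0 \<le> det (Q_mat M B h)"
    then have "G_kernel M B c h z y * g z \<le> 0" for z
      unfolding G_kernel_def Let_def
      by (intro mult_nonpos_nonneg mult_nonneg_nonpos assms)
         (auto simp: divide_nonneg_nonpos mult_nonneg_nonpos)
    \<comment> \<open>\<open>ennreal\<close> truncates negative values to 0. Since the determinant
      does not involve \<open>y\<close>, one point \<open>y\<close> settles the sign at every
      \<open>y'\<close>.\<close>
    then have "G_op_nn M B c h g y = 0"
      by (simp add: G_op_nn_def ennreal_neg)
    with assms(1) show False by simp
  qed
  then show ?thesis
    by (simp add: G_kernel_def Let_def)
qed

section \<open>Weighted norms, weights and moments\<close>

lemma C_k_continuous: "C_k n f \<Longrightarrow> continuous_on UNIV f"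
  by (cases n) auto

lemma Linf_norm_le_Ck_norm: "Linf_norm \<omega> f \<le> Ck_norm n \<omega> (f :: real^'n::finite \<Rightarrow> real)"
proof -
  \<comment> \<open>Finiteness matters: a sum over an infinite set would be 0 by default.\<close>
  have fin: "finite {\<alpha> :: 'n \<Rightarrow> nat. (\<Sum>i\<in>UNIV. \<alpha> i) \<le> n}"
  proof (rule finite_subset)
    show "{\<alpha> :: 'n \<Rightarrow> nat. (\<Sum>i\<in>UNIV. \<alpha> i) \<le> n} \<subseteq> UNIV \<rightarrow>\<^sub>E {..n}"
    proof (clarsimp simp: PiE_UNIV_domain)
      fix \<alpha> :: "'n \<Rightarrow> nat" and i
      assume "(\<Sum>i\<in>UNIV. \<alpha> i) \<le> n"
      moreover have "\<alpha> i \<le> (\<Sum>i\<in>UNIV. \<alpha> i)"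
        by (rule member_le_sum) auto
      ultimately show "\<alpha> i \<le> n"
        by simp
    qed
    show "finite ((UNIV :: 'n set) \<rightarrow>\<^sub>E {..n})"
      by (rule finite_PiE) auto
  qed
  \<comment> \<open>For the zero multi-index the choice is forced to be the empty list, so its
    summand is the norm of \<open>f\<close> itself.\<close>
  have "(SOME is :: 'n list. \<forall>i. count_list is i = 0) = []"
    by (rule some_equality) (auto simp: count_list_0_iff)
  then have "multi_partial (\<lambda>_. 0) f = f"
    by (simp add: multi_partial_def)
  then show ?thesis
    unfolding Ck_norm_def
    using member_le_sum[of "\<lambda>_. 0" "{\<alpha> :: 'n \<Rightarrow> nat. (\<Sum>i\<in>UNIV. \<alpha> i) \<le> n}"
        "\<lambda>\<alpha>. Linf_norm \<omega> (multi_partial \<alpha> f)"] fin by simp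
qed

lemma Linf_norm_leD:
  assumes "Linf_norm \<omega> g \<le> ennreal K" "0 \<le> K" "0 < \<omega> z"
  shows "\<bar>g z\<bar> \<le> K * \<omega> z"
proof -
  have "ennreal (\<bar>g z\<bar> / \<omega> z) \<le> ennreal K"
    using assms(1) unfolding Linf_norm_def by (auto simp: SUP_le_iff)
  then show ?thesis
    using assms by (simp add: pos_divide_le_eq)
qed

lemma weight_ge_1: "0 \<le> \<theta> \<Longrightarrow> 1 \<le> weight \<iota> \<theta> z"
  by (simp add: weight_def)

lemma weight_le_weight_plus:
  assumes "0 \<le> \<theta>" "0 \<le> \<theta>'"
  shows "weight \<iota> \<theta> z \<le> weight_plus \<iota> \<theta> \<theta>' m z"
proof -
  let ?p = "(1 + norm (x_part \<iota> z) + norm (v_part \<iota> z)) ^ (2 * m)"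
  have "1 \<le> weight \<iota> \<theta> z" "1 \<le> weight \<iota> \<theta>' z" "1 \<le> ?p"
    using assms by (auto simp: weight_ge_1 intro!: one_le_power)
  then have "1 * (weight \<iota> \<theta> z * 1) * 1 \<le> ?p * (weight \<iota> \<theta> z * weight \<iota> \<theta> z) * weight \<iota> \<theta>' z"
    by (intro mult_mono) auto
  then show ?thesis
    by (simp add: weight_plus_def power2_eq_square)
qed

lemma weight_plus_measurable [measurable]:
  fixes \<iota> :: "'v::finite \<Rightarrow> 'a::finite"
  shows "weight_plus \<iota> \<theta> \<theta>' m \<in> borel_measurable borel"
proof -
  \<comment> \<open>In \<open>x_part\<close> the condition concerns the index only, so each
    component is either constantly 0 or a coordinate.\<close>
  have if_0: "continuous_on UNIV (\<lambda>z :: real^'a. if P then 0 else z $ i)" for P and i :: 'a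
    by (cases P) (auto intro!: continuous_intros)
  have "continuous_on UNIV (weight_plus \<iota> \<theta> \<theta>' m)"
    unfolding weight_plus_def weight_def x_part_def v_part_def
    by (intro continuous_intros continuous_on_vec_lambda if_0)
  then show ?thesis
    by (rule borel_measurable_continuous_onI)
qed

text \<open>Turns a pointwise weighted bound into a bound on the integral against a density.
  Measurability is asked of the product with \<open>\<rho>\<close> because in the error estimates it
  is read off from integrability of that product.\<close>

lemma moment_bound:
  assumes [measurable]: "(\<lambda>z. g z * \<rho> z) \<in> borel_measurable borel" "\<omega> \<in> borel_measurable borel"
    and \<rho>: "prob_density \<rho>" "moment \<omega> \<rho> < \<infinity>"
    and bound: "\<And>z. \<bar>g z\<bar> \<le> K * \<omega> z" and K: "0 \<le> K" "\<And>z. 0 \<le> \<omega> z"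
  shows "integrable lborel (\<lambda>z. g z * \<rho> z)"
    and "ennreal \<bar>\<integral> z. g z * \<rho> z \<partial>lborel\<bar> \<le> ennreal K * moment \<omega> \<rho>"
proof -
  have [measurable]: "\<rho> \<in> borel_measurable borel" and \<rho>0: "\<And>z. 0 \<le> \<rho> z"
    using \<rho> by (auto simp: prob_density_def)
  have "(\<integral>\<^sup>+ z. ennreal (norm (g z * \<rho> z)) \<partial>lborel)
      \<le> (\<integral>\<^sup>+ z. ennreal K * ennreal (\<omega> z * \<rho> z) \<partial>lborel)"
    using bound \<rho>0 K
    by (intro nn_integral_mono)
       (auto simp: abs_mult ennreal_mult'[symmetric] mult.assoc[symmetric] intro!: ennreal_leI mult_right_mono)
  also have "\<dots> = ennreal K * moment \<omega> \<rho>"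
    by (simp add: nn_integral_cmult moment_def)
  finally have le: "(\<integral>\<^sup>+ z. ennreal (norm (g z * \<rho> z)) \<partial>lborel) \<le> ennreal K * moment \<omega> \<rho>" .
  moreover have "ennreal K * moment \<omega> \<rho> < \<infinity>"
    using \<rho>(2) by (auto simp: ennreal_mult_less_top)
  ultimately show int: "integrable lborel (\<lambda>z. g z * \<rho> z)"
    by (intro integrableI_bounded) auto
  have "ennreal (norm (\<integral> z. g z * \<rho> z \<partial>lborel)) \<le> (\<integral>\<^sup>+ z. ennreal (norm (g z * \<rho> z)) \<partial>lborel)"
    by (rule integral_norm_bound_ennreal[OF int])
  with le show "ennreal \<bar>\<integral> z. g z * \<rho> z \<partial>lborel\<bar> \<le> ennreal K * moment \<omega> \<rho>"
    by simp
qed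

section \<open>Taylor remainder and telescoping\<close>

text \<open>Two mean value inequalities, first for \<open>g'\<close>, then for \<open>g\<close>
  minus its linear part. This works with mere existence of \<open>g''\<close>, at the price of
  \<open>K\<close> in place of \<open>K / 2\<close>. Derivatives are taken within the interval to
  match \<open>time_deriv\<close>.\<close>

lemma second_order_remainder_bound:
  fixes g g' g'' :: "real \<Rightarrow> real"
  assumes g: "\<And>t. t \<in> {a..b} \<Longrightarrow> (g has_real_derivative g' t) (at t within {a..b})"
    and g': "\<And>t. t \<in> {a..b} \<Longrightarrow> (g' has_real_derivative g'' t) (at t within {a..b})"
    and bound: "\<And>t. t \<in> {a..b} \<Longrightarrow> \<bar>g'' t\<bar> \<le> K"
    and s: "a \<le> s" "0 \<le> h" "s + h \<le> b"
  shows "\<bar>g (s + h) - g s - h * g' s\<bar> \<le> K * h\<^sup>2"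
proof -
  have K: "0 \<le> K"
    using bound[of s] s by force
  have 1: "\<bar>g' t - g' s\<bar> \<le> K * h" if "t \<in> {s..s+h}" for t
  proof -
    have "norm (g' t - g' s) \<le> K * norm (t - s)"
      by (rule field_differentiable_bound[of "{a..b}" g' g'']) (use g' bound s that in auto)
    also have "\<dots> \<le> K * h"
      using that K by (intro mult_left_mono) auto
    finally show ?thesis by simp
  qed
  have "norm ((g (s + h) - g' s * (s + h)) - (g s - g' s * s)) \<le> (K * h) * norm (s + h - s)"
  proof (rule field_differentiable_bound[of "{s..s+h}" "\<lambda>t. g t - g' s * t" "\<lambda>t. g' t - g' s"])
    fix t assume t: "t \<in> {s..s+h}"
    have "(g has_real_derivative g' t) (at t within {s..s+h})"
      by (rule DERIV_subset[OF g]) (use t s in auto)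
    then show "((\<lambda>t. g t - g' s * t) has_real_derivative g' t - g' s) (at t within {s..s+h})"
      by (auto intro!: derivative_eq_intros)
    show "norm (g' t - g' s) \<le> K * h"
      using 1[OF t] by simp
  qed (use s in auto)
  then show ?thesis
    using s by (simp add: algebra_simps power2_eq_square)
qed

lemma abs_diff_le_sum_steps:
  fixes a :: "nat \<Rightarrow> real"
  assumes "\<And>k. k < n \<Longrightarrow> \<bar>a (Suc k) - a k\<bar> \<le> d"
  shows "\<bar>a n - a 0\<bar> \<le> real n * d"
proof -
  have "\<bar>a n - a 0\<bar> = \<bar>\<Sum>k<n. a (Suc k) - a k\<bar>"
    by (simp add: sum_lessThan_telescope)
  also have "\<dots> \<le> (\<Sum>k<n. \<bar>a (Suc k) - a k\<bar>)"
    by (rule sum_abs)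
  also have "\<dots> \<le> real n * d"
    using sum_bounded_above[of "{..<n}" "\<lambda>k. \<bar>a (Suc k) - a k\<bar>" d] assms by simp
  finally show ?thesis .
qed

section \<open>The Doob-transformed kernel and its duality\<close>

text \<open>
  Dividing \<open>\<psi>(z) G\<^sub>h(z | y)\<close> by \<open>(G\<^sub>h\<psi>)(y)\<close> normalises its integral over \<open>z\<close> to \<open>1\<close>: this is the Doob
  transform of the Gaussian kernel, and \<open>K_aff\<close> is the action of the transformed kernel on densities.
\<close>

definition doob_kernel :: "real^'n^'n \<Rightarrow> real^'n^'n \<Rightarrow> real^'n \<Rightarrow> (real^'n::finite \<Rightarrow> real) \<Rightarrow> real \<Rightarrow>
    real^'n \<Rightarrow> real^'n \<Rightarrow> real" where
  "doob_kernel M B c \<phi> h z y = psi \<phi> z * G_kernel M B c h z y / G_op M B c h (psi \<phi>) y"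

context
  fixes M B :: "real^'n^'n::finite" and c :: "real^'n" and \<phi> :: "real^'n \<Rightarrow> real" and h :: real
  assumes cont: "continuous_on UNIV \<phi>"
    and fin: "\<And>y. 0 < G_op_nn M B c h (psi \<phi>) y \<and> G_op_nn M B c h (psi \<phi>) y < \<infinity>"
begin

lemma psi_measurable [measurable]: "psi \<phi> \<in> borel_measurable borel"
  unfolding psi_def using cont by (intro borel_measurable_continuous_onI continuous_intros) auto

lemma psi_pos: "0 < psi \<phi> z"
  by (simp add: psi_def)

lemma G_kernel_ge_0: "0 \<le> G_kernel M B c h z y"
  by (rule G_kernel_nonneg[where g = "psi \<phi>" and y = 0]) (use fin psi_pos in \<open>auto simp: less_imp_le\<close>)

text \<open>Finiteness of the extended integral ensures that \<open>G_op\<close> is its true value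
  and not the default 0, so dividing by it is legitimate.\<close>

lemma G_op_psi: "ennreal (G_op M B c h (psi \<phi>) y) = G_op_nn M B c h (psi \<phi>) y"
  and G_op_psi_pos: "0 < G_op M B c h (psi \<phi>) y"
proof -
  have nonneg: "0 \<le> G_kernel M B c h z y * psi \<phi> z" for z
    using G_kernel_ge_0 psi_pos[of z] by simp
  have "integrable lborel (\<lambda>z. G_kernel M B c h z y * psi \<phi> z)"
    using fin[of y] nonneg by (intro integrableI_nonneg) (auto simp: G_op_nn_def)
  then show *: "ennreal (G_op M B c h (psi \<phi>) y) = G_op_nn M B c h (psi \<phi>) y"
    using nonneg by (simp add: G_op_def G_op_nn_def nn_integral_eq_integral)
  with fin[of y] show "0 < G_op M B c h (psi \<phi>) y"
    by (metis ennreal_less_zero_iff)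
qed

lemma doob_kernel_measurable [measurable]:
  "case_prod (doob_kernel M B c \<phi> h) \<in> borel_measurable (borel \<Otimes>\<^sub>M borel)"
  unfolding doob_kernel_def G_op_def by measurable

lemma doob_kernel_nonneg: "0 \<le> doob_kernel M B c \<phi> h z y"
  using G_kernel_ge_0 psi_pos[of z] G_op_psi_pos[of y]
  by (auto simp: doob_kernel_def less_imp_le)

lemma nn_integral_doob_kernel:
  assumes [measurable]: "f \<in> borel_measurable borel" and f: "\<And>z. 0 \<le> f z"
  shows "(\<integral>\<^sup>+ z. ennreal (doob_kernel M B c \<phi> h z y * f z) \<partial>lborel)
    = G_op_nn M B c h (\<lambda>z. psi \<phi> z * f z) y / G_op_nn M B c h (psi \<phi>) y"
proof -
  have "ennreal (doob_kernel M B c \<phi> h z y * f z)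
      = ennreal (G_kernel M B c h z y * (psi \<phi> z * f z)) / ennreal (G_op M B c h (psi \<phi>) y)" for z
    using G_kernel_ge_0 psi_pos[of z] G_op_psi_pos[of y] f[of z]
    by (subst divide_ennreal) (auto simp: doob_kernel_def mult_ac less_imp_le)
  then show ?thesis
    by (simp add: nn_integral_divide G_op_nn_def G_op_psi)
qed

text \<open>Valid for every \<open>f\<close>: constant factors leave a Bochner integral even when
  both sides default to 0.\<close>

lemma integral_doob_kernel:
  "(\<integral> z. doob_kernel M B c \<phi> h z y * f z \<partial>lborel)
    = G_op M B c h (\<lambda>z. psi \<phi> z * f z) y / G_op M B c h (psi \<phi>) y"
proof -
  have "(\<integral> z. doob_kernel M B c \<phi> h z y * f z \<partial>lborel)
      = (\<integral> z. (G_kernel M B c h z y * (psi \<phi> z * f z)) / G_op M B c h (psi \<phi>) y \<partial>lborel)"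
    by (simp add: doob_kernel_def mult_ac)
  then show ?thesis
    by (simp only: integral_divide_zero) (simp add: G_op_def)
qed

lemma K_aff_eq_doob_kernel:
  "K_aff M B c \<phi> h \<rho> = (\<lambda>z. \<integral> y. doob_kernel M B c \<phi> h z y * \<rho> y \<partial>lborel)"
proof
  fix z
  have "(\<integral> y. doob_kernel M B c \<phi> h z y * \<rho> y \<partial>lborel)
      = (\<integral> y. psi \<phi> z * (G_kernel M B c h z y * (\<rho> y / G_op M B c h (psi \<phi>) y)) \<partial>lborel)"
    by (simp add: doob_kernel_def mult_ac)
  then show "K_aff M B c \<phi> h \<rho> z = (\<integral> y. doob_kernel M B c \<phi> h z y * \<rho> y \<partial>lborel)"
    by (simp only: K_aff_def integral_mult_right_zero)
qed

lemma prob_density_K_aff: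
  assumes "prob_density \<rho>"
  shows "prob_density (K_aff M B c \<phi> h \<rho>)"
  unfolding K_aff_eq_doob_kernel
proof (rule kernel_prob_density)
  fix y
  show "(\<integral>\<^sup>+ z. ennreal (doob_kernel M B c \<phi> h z y) \<partial>lborel) = 1"
    \<comment> \<open>For the constant function 1 the quotient has equal numerator and denominator;
      it is 1 because this value is neither 0 nor infinite.\<close>
    using nn_integral_doob_kernel[of "\<lambda>_. 1" y] fin[of y]
    by (auto simp: zero_less_iff_neq_zero)
qed (use assms doob_kernel_nonneg in auto)

text \<open>The last assumption has the form of \<open>integrability\<close> in the theorem; through
  \<open>nn_integral_doob_kernel\<close> it becomes the condition under which Fubini's theorem
  applies.\<close>

lemma K_aff_adjoint:
  assumes [measurable]: "f \<in> borel_measurable borel" and \<rho>: "prob_density \<rho>"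
    and "(\<integral>\<^sup>+ y. G_op_nn M B c h (\<lambda>z. psi \<phi> z * \<bar>f z\<bar>) y / G_op_nn M B c h (psi \<phi>) y
            * ennreal (\<rho> y) \<partial>lborel) < \<infinity>"
  shows "integrable lborel (\<lambda>z. f z * K_aff M B c \<phi> h \<rho> z)"
    and "integrable lborel
      (\<lambda>y. G_op M B c h (\<lambda>z. psi \<phi> z * f z) y / G_op M B c h (psi \<phi>) y * \<rho> y)"
    and "(\<integral> z. f z * K_aff M B c \<phi> h \<rho> z \<partial>lborel)
      = (\<integral> y. G_op M B c h (\<lambda>z. psi \<phi> z * f z) y / G_op M B c h (psi \<phi>) y * \<rho> y \<partial>lborel)"
proof -
  have fin': "(\<integral>\<^sup>+ y. (\<integral>\<^sup>+ z. ennreal (doob_kernel M B c \<phi> h z y * \<bar>f z\<bar>) \<partial>lborel)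
      * ennreal (\<rho> y) \<partial>lborel) < \<infinity>"
    using assms(3) by (simp add: nn_integral_doob_kernel)
  have [measurable]: "\<rho> \<in> borel_measurable borel" and \<rho>0: "\<And>z. 0 \<le> \<rho> z"
    using \<rho> by (auto simp: prob_density_def)
  note adj = kernel_adjoint[OF doob_kernel_measurable assms(1) \<open>\<rho> \<in> borel_measurable borel\<close>
      doob_kernel_nonneg \<rho>0 fin']
  show "integrable lborel (\<lambda>z. f z * K_aff M B c \<phi> h \<rho> z)"
    using adj(1) by (simp add: K_aff_eq_doob_kernel)
  show "integrable lborel
      (\<lambda>y. G_op M B c h (\<lambda>z. psi \<phi> z * f z) y / G_op M B c h (psi \<phi>) y * \<rho> y)"
    using adj(2) by (simp add: integral_doob_kernel)
  show "(\<integral> z. f z * K_aff M B c \<phi> h \<rho> z \<partial>lborel)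
      = (\<integral> y. G_op M B c h (\<lambda>z. psi \<phi> z * f z) y / G_op M B c h (psi \<phi>) y * \<rho> y \<partial>lborel)"
    using adj(3) by (simp add: integral_doob_kernel K_aff_eq_doob_kernel)
qed

end

theorem corollary3p1:
  fixes \<iota> :: "'v::finite \<Rightarrow> 'n::finite"
    and A :: "real^'v^'v" and \<A> B :: "real^'n^'n" and c :: "real^'n"
    and \<phi> \<psi> W W2 :: "real^'n \<Rightarrow> real"
    and L :: "(real^'n \<Rightarrow> real) \<Rightarrow> real^'n \<Rightarrow> real"
    and K :: "real \<Rightarrow> (real^'n \<Rightarrow> real) \<Rightarrow> real^'n \<Rightarrow> real"
    and \<theta> \<theta>' h\<^sub>0 C :: real and m :: nat
  assumes "inj \<iota>"
    and "pos_def A"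
    and \<A>: "\<A> = diag_zero \<iota> A"
    and kalman: "kalman_rank_condition \<A> B"
    and "C_k 1 \<phi>"
    and \<psi>: "\<psi> = psi \<phi>"
    and L: "L = L_op \<iota> A B c \<phi>"
    and K: "K = K_aff \<A> B c \<phi>"
    and "0 < \<theta>" "\<theta> < \<theta>'"
    and W: "W = weight \<iota> \<theta>"
    and W2: "W2 = weight_plus \<iota> \<theta> \<theta>' m"
    and "0 < h\<^sub>0" "0 < C"
    and G_finite: "\<forall>h\<in>{0<..h\<^sub>0}. \<forall>y. 0 < G_op_nn \<A> B c h \<psi> y \<and> G_op_nn \<A> B c h \<psi> y < \<infinity>"
    and G_ratio: "\<forall>h\<in>{0<..h\<^sub>0}.
      Linf_norm W (\<lambda>y. G_op \<A> B c h \<psi> y / \<psi> y) + Linf_norm W (\<lambda>y. \<psi> y / G_op \<A> B c h \<psi> y)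
        \<le> ennreal C"
    and consistency: "\<forall>h\<in>{0<..h\<^sub>0}. \<forall>f\<in>Ck_space 4 W.
      Linf_norm W2 (\<lambda>y. G_op \<A> B c h (\<lambda>z. \<psi> z * f z) y / G_op \<A> B c h \<psi> y - f y - h * L f y)
        \<le> ennreal (C * h\<^sup>2) * Ck_norm 4 W f"
    and integrability: "\<forall>f\<in>Ck_space 4 W. \<forall>h\<in>{0<..h\<^sub>0}. \<forall>\<rho>.
      prob_density \<rho> \<and> moment W2 \<rho> < \<infinity> \<longrightarrow>
        (\<integral>\<^sup>+ y. G_op_nn \<A> B c h (\<lambda>z. \<psi> z * \<bar>f z\<bar>) y / G_op_nn \<A> B c h \<psi> y * ennreal (\<rho> y) \<partial>lborel) < \<infinity> \<and>
        integrable lborel (\<lambda>y. L f y * \<rho> y)"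
  shows
    "(\<forall>T>0. \<exists>h\<^sub>T C\<^sub>T. 0 < h\<^sub>T \<and> h\<^sub>T \<le> min h\<^sub>0 T \<and> 0 < C\<^sub>T \<and> one_step_bound L K W W2 h\<^sub>T C\<^sub>T)
     \<and>
     (\<forall>T>0. \<forall>(\<rho> :: real \<Rightarrow> real^'n \<Rightarrow> real)
           (u :: (real^'n \<Rightarrow> real) \<Rightarrow> real \<Rightarrow> real^'n \<Rightarrow> real) h\<^sub>T C\<^sub>T.
        0 < h\<^sub>T \<and> h\<^sub>T \<le> min h\<^sub>0 T \<and> 0 < C\<^sub>T \<and> one_step_bound L K W W2 h\<^sub>T C\<^sub>T \<longrightarrow>
        (\<forall>t\<in>{0..T}. prob_density (\<rho> t)) \<and> forward_solution \<iota> A B c \<phi> T \<rho> \<longrightarrow>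
        (\<exists>C\<^sub>1. \<forall>f\<in>Ck_space 4 W. backward_solution \<iota> A B c \<phi> T f (u f) \<and>
           (SUP t\<in>{0..T}. Ck_norm 4 W (u f t)) +
           (SUP t\<in>{0..T}. Linf_norm W2 (time_deriv T (time_deriv T (u f)) t))
             \<le> ennreal C\<^sub>1 * Ck_norm 4 W f) \<longrightarrow>
        (\<forall>f\<in>Ck_space 4 W. \<forall>t\<in>{0..T}.
           (\<integral> z. f z * \<rho> t z \<partial>lborel) = (\<integral> z. u f t z * \<rho> 0 z \<partial>lborel)) \<longrightarrow>
        (\<exists>h' M. 0 < h' \<and> h' \<le> min h\<^sub>0 1 \<and> 0 < M \<and>
           (SUP t\<in>{0..T}. moment W2 (\<rho> t)) +
           (SUP h\<in>{0<..h'}. SUP k\<in>{k. real k * h \<le> T}. moment W2 ((K h ^^ k) (\<rho> 0)))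
             \<le> ennreal M) \<longrightarrow>
        (\<exists>h\<^sub>T' C\<^sub>T'. 0 < h\<^sub>T' \<and> h\<^sub>T' \<le> h\<^sub>T \<and> C\<^sub>T \<le> C\<^sub>T' \<and>
           global_bound K W T \<rho> h\<^sub>T' C\<^sub>T'))"
proof -

  \<comment> \<open>Preliminaries on weights and integrability\<close>
  have cont: "continuous_on UNIV \<phi>"
    using \<open>C_k 1 \<phi>\<close> by (rule C_k_continuous)
  note fin = G_finite[unfolded \<psi>, rule_format]
  have W_pos: "0 < W z" and W_le: "W z \<le> W2 z" and W2_ge_0: "0 \<le> W2 z" for z
  proof -
    show "W z \<le> W2 z"
      using \<open>0 < \<theta>\<close> \<open>\<theta> < \<theta>'\<close> unfolding W W2 by (intro weight_le_weight_plus) auto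
    moreover show "0 < W z"
      by (simp add: W weight_def)
    ultimately show "0 \<le> W2 z"
      by simp
  qed
  have W2_pos: "0 < W2 z" for z
    using W_pos[of z] W_le[of z] by simp
  have W2_meas [measurable]: "W2 \<in> borel_measurable borel"
    by (simp add: W2)
  have f_meas: "f \<in> borel_measurable borel" if "f \<in> Ck_space 4 W" for f
    using that by (auto simp: Ck_space_def intro!: borel_measurable_continuous_onI C_k_continuous)
  have norm_eq: "Ck_norm 4 W f = ennreal (enn2real (Ck_norm 4 W f))" if "f \<in> Ck_space 4 W" for f
    using that by (simp add: Ck_space_def)
  \<comment> \<open>The product \<open>f z * \<rho> z\<close> is dominated through
    \<open>W \<le> W2\<close> and the finite \<open>W2\<close>-moment.\<close>
  have f_int: "integrable lborel (\<lambda>z. f z * \<rho> z)"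
    if f: "f \<in> Ck_space 4 W" and \<rho>: "prob_density \<rho>" "moment W2 \<rho> < \<infinity>" for f \<rho>
  proof (rule moment_bound(1)[OF _ W2_meas \<rho> _ enn2real_nonneg W2_ge_0])
    show "(\<lambda>z. f z * \<rho> z) \<in> borel_measurable borel"
      using f_meas[OF f] \<rho>(1) by (auto simp: prob_density_def)
    fix z
    have "\<bar>f z\<bar> \<le> enn2real (Ck_norm 4 W f) * W z"
      using Linf_norm_le_Ck_norm[of W f 4] norm_eq[OF f] W_pos by (intro Linf_norm_leD) auto
    also have "\<dots> \<le> enn2real (Ck_norm 4 W f) * W2 z"
      by (intro mult_left_mono W_le) auto
    finally show "\<bar>f z\<bar> \<le> enn2real (Ck_norm 4 W f) * W2 z" .
  qed

  \<comment> \<open>The one-step estimate, with the consistency constant \<open>C\<close>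
    itself\<close>
  have one_step: "one_step_bound L K W W2 h\<^sub>T C" if hT: "h\<^sub>T \<le> h\<^sub>0" for h\<^sub>T
    unfolding one_step_bound_def
  proof (intro ballI allI impI, elim conjE)
    fix f \<rho> h
    assume f: "f \<in> Ck_space 4 W" and \<rho>: "prob_density \<rho>" "moment W2 \<rho> < \<infinity>" and "h \<in> {0<..h\<^sub>T}"
    with hT have h: "h \<in> {0<..h\<^sub>0}"
      by auto
    let ?P = "\<lambda>y. G_op \<A> B c h (\<lambda>z. \<psi> z * f z) y / G_op \<A> B c h \<psi> y"
    let ?N = "enn2real (Ck_norm 4 W f)"
    have int: "(\<integral>\<^sup>+ y. G_op_nn \<A> B c h (\<lambda>z. psi \<phi> z * \<bar>f z\<bar>) y / G_op_nn \<A> B c h (psi \<phi>) y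
        * ennreal (\<rho> y) \<partial>lborel) < \<infinity>" and L_int: "integrable lborel (\<lambda>y. L f y * \<rho> y)"
      using integrability f \<rho> h unfolding \<psi> by blast+
    note adj = K_aff_adjoint[OF cont fin[OF h] f_meas[OF f] \<rho>(1) int, folded \<psi> K]
    \<comment> \<open>Duality replaces the first term; the three separate integrabilities justify
      splitting and recombining the integral.\<close>
    have "(\<integral> z. f z * K h \<rho> z - f z * \<rho> z - h * (L f z * \<rho> z) \<partial>lborel)
        = (\<integral> y. ?P y * \<rho> y - f y * \<rho> y - h * (L f y * \<rho> y) \<partial>lborel)"
      using adj f_int[OF f \<rho>] L_int by simp
    also have "\<dots> = (\<integral> y. (?P y - f y - h * L f y) * \<rho> y \<partial>lborel)"
      by (simp add: algebra_simps)
    finally have eq: "(\<integral> z. f z * K h \<rho> z - f z * \<rho> z - h * (L f z * \<rho> z) \<partial>lborel)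
        = (\<integral> y. (?P y - f y - h * L f y) * \<rho> y \<partial>lborel)" .
    have "integrable lborel (\<lambda>y. ?P y * \<rho> y - f y * \<rho> y - h * (L f y * \<rho> y))"
      using adj(2) f_int[OF f \<rho>] L_int by simp
    then have meas: "(\<lambda>y. (?P y - f y - h * L f y) * \<rho> y) \<in> borel_measurable borel"
      using borel_measurable_integrable by (force simp: algebra_simps)
    have "Linf_norm W2 (\<lambda>y. ?P y - f y - h * L f y) \<le> ennreal (C * h\<^sup>2 * ?N)"
      using consistency[rule_format, OF h f] norm_eq[OF f] \<open>0 < C\<close> by (simp add: ennreal_mult)
    then have "ennreal \<bar>\<integral> y. (?P y - f y - h * L f y) * \<rho> y \<partial>lborel\<bar>
        \<le> ennreal (C * h\<^sup>2 * ?N) * moment W2 \<rho>"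
      using \<open>0 < C\<close> W2_pos W2_ge_0
      by (intro moment_bound(2)[OF meas W2_meas \<rho>] Linf_norm_leD) auto
    then show "ennreal \<bar>\<integral> z. f z * K h \<rho> z - f z * \<rho> z - h * (L f z * \<rho> z) \<partial>lborel\<bar>
        \<le> ennreal (C * h\<^sup>2) * Ck_norm 4 W f * moment W2 \<rho>"
      using eq norm_eq[OF f] \<open>0 < C\<close> by (simp add: ennreal_mult)
  qed

  \<comment> \<open>The global estimate\<close>
  have "\<exists>h\<^sub>T' C\<^sub>T'. 0 < h\<^sub>T' \<and> h\<^sub>T' \<le> h\<^sub>T \<and> C\<^sub>T \<le> C\<^sub>T' \<and> global_bound K W T \<rho> h\<^sub>T' C\<^sub>T'"
    if "0 < T" and hT: "0 < h\<^sub>T" "h\<^sub>T \<le> min h\<^sub>0 T" and CT: "0 < C\<^sub>T"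
      and step: "one_step_bound L K W W2 h\<^sub>T C\<^sub>T"
      and \<rho>: "\<forall>t\<in>{0..T}. prob_density (\<rho> t)"
      and u: "\<forall>f\<in>Ck_space 4 W. backward_solution \<iota> A B c \<phi> T f (u f) \<and>
           (SUP t\<in>{0..T}. Ck_norm 4 W (u f t)) +
           (SUP t\<in>{0..T}. Linf_norm W2 (time_deriv T (time_deriv T (u f)) t))
             \<le> ennreal C\<^sub>1 * Ck_norm 4 W f"
      and duality: "\<forall>f\<in>Ck_space 4 W. \<forall>t\<in>{0..T}.
           (\<integral> z. f z * \<rho> t z \<partial>lborel) = (\<integral> z. u f t z * \<rho> 0 z \<partial>lborel)"
      and h': "0 < h'" "h' \<le> min h\<^sub>0 1" and M: "0 < M"
      and moments: "(SUP t\<in>{0..T}. moment W2 (\<rho> t)) +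
           (SUP h\<in>{0<..h'}. SUP k\<in>{k. real k * h \<le> T}. moment W2 ((K h ^^ k) (\<rho> 0))) \<le> ennreal M"
    for T h\<^sub>T C\<^sub>T C\<^sub>1 h' M and \<rho> :: "real \<Rightarrow> real^'n \<Rightarrow> real"
      and u :: "(real^'n \<Rightarrow> real) \<Rightarrow> real \<Rightarrow> real^'n \<Rightarrow> real"
  proof -
    \<comment> \<open>\<open>C\<^sub>1\<close> may be negative; \<open>ennreal\<close> cannot tell
      it from 0 then, so the nonnegative part gives the same bound.\<close>
    define C\<^sub>2 where "C\<^sub>2 = max 0 C\<^sub>1"
    \<comment> \<open>Each step costs
      \<open>(C\<^sub>T + 1) * C\<^sub>2 * M * N * h\<^sup>2\<close>, and
      \<open>n * h \<le> T\<close> turns \<open>n\<close> steps into the second summand. The first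
      summand secures \<open>C\<^sub>T \<le> C\<^sub>T'\<close>.\<close>
    define C\<^sub>T' where "C\<^sub>T' = C\<^sub>T + T * ((C\<^sub>T + 1) * C\<^sub>2 * M)"
    have C2: "0 \<le> C\<^sub>2" "ennreal C\<^sub>1 = ennreal C\<^sub>2"
      by (auto simp: C\<^sub>2_def max_def ennreal_neg)
    have CT': "C\<^sub>T \<le> C\<^sub>T'"
      using \<open>0 < T\<close> CT C2 M by (auto simp: C\<^sub>T'_def)
    \<comment> \<open>The one-step bound holds for \<open>h\<close> up to \<open>h\<^sub>T\<close>,
      the moment bound up to \<open>h'\<close>.\<close>
    have "global_bound K W T \<rho> (min h\<^sub>T h') C\<^sub>T'"
      unfolding global_bound_def
    proof (intro ballI allI impI)
      fix f h n
      assume f: "f \<in> Ck_space 4 W" and "h \<in> {0<..min h\<^sub>T h'}" and n: "real n * h \<le> T"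
      then have h: "0 < h" "h \<in> {0<..h\<^sub>T}" "h \<in> {0<..h'}" "h \<in> {0<..h\<^sub>0}"
        using hT by auto
      define N where "N = enn2real (Ck_norm 4 W f)"
      have N: "0 \<le> N" "Ck_norm 4 W f = ennreal N"
        using norm_eq[OF f] by (simp_all add: N_def)
      let ?\<rho> = "\<lambda>k. (K h ^^ k) (\<rho> 0)"
      let ?u = "u f" and ?u' = "time_deriv T (u f)" and ?u'' = "time_deriv T (time_deriv T (u f))"
      have u0: "?u 0 = f" and u_Ck: "\<And>t. t \<in> {0..T} \<Longrightarrow> C_k 4 (?u t)"
        and diff: "time_differentiable T ?u" "time_differentiable T ?u'"
        and eqn: "\<And>t z. t \<in> {0..T} \<Longrightarrow> ?u' t z = L (?u t) z"
        using u f by (auto simp: backward_solution_def L)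
      have "(SUP t\<in>{0..T}. Ck_norm 4 W (?u t)) + (SUP t\<in>{0..T}. Linf_norm W2 (?u'' t))
          \<le> ennreal (C\<^sub>2 * N)"
        using u f C2 N by (auto simp: ennreal_mult)
      then have "(SUP t\<in>{0..T}. Ck_norm 4 W (?u t)) \<le> ennreal (C\<^sub>2 * N)"
        and "(SUP t\<in>{0..T}. Linf_norm W2 (?u'' t)) \<le> ennreal (C\<^sub>2 * N)"
        by (auto intro: order_trans[rotated])
      then have u_norm: "\<And>t. t \<in> {0..T} \<Longrightarrow> Ck_norm 4 W (?u t) \<le> ennreal (C\<^sub>2 * N)"
        and u''_norm: "\<And>t. t \<in> {0..T} \<Longrightarrow> Linf_norm W2 (?u'' t) \<le> ennreal (C\<^sub>2 * N)"
        by (auto simp: SUP_le_iff)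
      have u_space: "?u t \<in> Ck_space 4 W" if "t \<in> {0..T}" for t
        using u_Ck[OF that] u_norm[OF that] by (auto simp: Ck_space_def intro: le_less_trans)
      have deriv: "((\<lambda>s. w s z) has_real_derivative time_deriv T w t z) (at t within {0..T})"
        if "time_differentiable T w" "t \<in> {0..T}" for w t z
        using that \<open>0 < T\<close> unfolding time_differentiable_def time_deriv_def
        by (simp add: has_real_derivative_iff_has_vector_derivative vector_derivative_works)
      have mom: "moment W2 (?\<rho> k) \<le> ennreal M" if "real k * h \<le> T" for k
      proof -
        have "moment W2 (?\<rho> k) \<le> (SUP k\<in>{k. real k * h \<le> T}. moment W2 (?\<rho> k))"
          using that by (intro SUP_upper) auto
        also have "\<dots> \<le> (SUP h\<in>{0<..h'}. SUP k\<in>{k. real k * h \<le> T}. moment W2 ((K h ^^ k) (\<rho> 0)))"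
          using h by (intro SUP_upper2[of h]) auto
        also have "\<dots> \<le> ennreal M"
          using moments by (auto intro: order_trans[rotated])
        finally show ?thesis .
      qed
      \<comment> \<open>Needed at every iterate, since the one-step bound speaks of probability
        densities only.\<close>
      have dens: "prob_density (?\<rho> k)" for k
      proof (induction k)
        case (Suc k)
        then show ?case
          using prob_density_K_aff[OF cont fin[OF h(4)]] by (simp add: K)
      qed (use \<rho> \<open>0 < T\<close> in auto)
      \<comment> \<open>In the factor \<open>C\<^sub>T + 1\<close>, the one-step error contributes
        \<open>C\<^sub>T\<close> and the Taylor remainder contributes 1.\<close>
      have increment: "\<bar>(\<integral> z. ?u s z * ?\<rho> (Suc k) z \<partial>lborel) - (\<integral> z. ?u (s + h) z * ?\<rho> k z \<partial>lborel)\<bar>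
          \<le> (C\<^sub>T + 1) * C\<^sub>2 * M * N * h\<^sup>2"
        if k: "real (Suc k) * h \<le> T" and s: "0 \<le> s" "s + h \<le> T" for k s
      proof -
        have k': "real k * h \<le> T"
          using k h(1) by (simp add: algebra_simps)
        have s': "s \<in> {0..T}" "s + h \<in> {0..T}"
          using s h(1) by auto
        note us = u_space[OF s'(1)] and ush = u_space[OF s'(2)]
        have fink: "moment W2 (?\<rho> k) < \<infinity>" and finSk: "moment W2 (?\<rho> (Suc k)) < \<infinity>"
          using mom[OF k] mom[OF k'] by (auto intro: le_less_trans)
        have L_int: "integrable lborel (\<lambda>z. L (?u s) z * ?\<rho> k z)"
          using integrability us h(4) dens fink by blast
        note ints = f_int[OF us dens finSk] f_int[OF us dens fink] f_int[OF ush dens fink] L_int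
        have "ennreal \<bar>\<integral> z. ?u s z * ?\<rho> (Suc k) z - ?u s z * ?\<rho> k z - h * (L (?u s) z * ?\<rho> k z) \<partial>lborel\<bar>
            \<le> ennreal (C\<^sub>T * h\<^sup>2) * Ck_norm 4 W (?u s) * moment W2 (?\<rho> k)"
          using step us h(2) dens[of k] fink unfolding one_step_bound_def by simp
        also have "\<dots> \<le> ennreal (C\<^sub>T * h\<^sup>2) * ennreal (C\<^sub>2 * N) * ennreal M"
          by (intro mult_mono u_norm s' mom k') auto
        also have "\<dots> = ennreal (C\<^sub>T * C\<^sub>2 * M * N * h\<^sup>2)"
          using CT C2 N M by (simp add: ennreal_mult[symmetric] mult_ac)
        finally have 1: "\<bar>\<integral> z. ?u s z * ?\<rho> (Suc k) z - ?u s z * ?\<rho> k z - h * (L (?u s) z * ?\<rho> k z) \<partial>lborel\<bar>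
            \<le> C\<^sub>T * C\<^sub>2 * M * N * h\<^sup>2"
          using CT C2 N M by simp
        \<comment> \<open>Taylor's formula in time at fixed \<open>z\<close>, with
          \<open>C\<^sub>2 * N * W2 z\<close> bounding the second derivative; the backward equation
          then replaces the time derivative by \<open>L\<close>.\<close>
        have taylor: "\<bar>?u (s + h) z - ?u s z - h * L (?u s) z\<bar> \<le> (C\<^sub>2 * N * h\<^sup>2) * W2 z" for z
        proof -
          have "\<bar>?u (s + h) z - ?u s z - h * ?u' s z\<bar> \<le> (C\<^sub>2 * N * W2 z) * h\<^sup>2"
          proof (rule second_order_remainder_bound[where a = 0 and b = T])
            fix t assume "t \<in> {0..T}"
            then show "\<bar>?u'' t z\<bar> \<le> C\<^sub>2 * N * W2 z"
              using C2 N W2_pos by (intro Linf_norm_leD u''_norm) auto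
          qed (use deriv diff s h(1) in auto)
          then show ?thesis
            by (simp add: eqn[OF s'(1)] mult_ac)
        qed
        have "integrable lborel (\<lambda>z. ?u (s + h) z * ?\<rho> k z - ?u s z * ?\<rho> k z - h * (L (?u s) z * ?\<rho> k z))"
          using ints by simp
        then have meas: "(\<lambda>z. (?u (s + h) z - ?u s z - h * L (?u s) z) * ?\<rho> k z) \<in> borel_measurable borel"
          using borel_measurable_integrable by (force simp: algebra_simps)
        have "ennreal \<bar>\<integral> z. (?u (s + h) z - ?u s z - h * L (?u s) z) * ?\<rho> k z \<partial>lborel\<bar>
            \<le> ennreal (C\<^sub>2 * N * h\<^sup>2) * moment W2 (?\<rho> k)"
          using C2 N W2_ge_0 by (intro moment_bound(2)[OF meas W2_meas dens fink taylor]) auto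
        also have "\<dots> \<le> ennreal (C\<^sub>2 * N * h\<^sup>2) * ennreal M"
          by (intro mult_left_mono mom k') auto
        also have "\<dots> = ennreal (C\<^sub>2 * N * h\<^sup>2 * M)"
          using C2 N M by (simp add: ennreal_mult[symmetric])
        finally have 2: "\<bar>\<integral> z. (?u (s + h) z - ?u s z - h * L (?u s) z) * ?\<rho> k z \<partial>lborel\<bar>
            \<le> C\<^sub>2 * N * h\<^sup>2 * M"
          using C2 N M by simp
        \<comment> \<open>The integrals of \<open>?u s\<close> and of \<open>h * L (?u s)\<close>
          against \<open>?\<rho> k\<close> occur in both errors and cancel.\<close>
        have "(\<integral> z. ?u s z * ?\<rho> (Suc k) z \<partial>lborel) - (\<integral> z. ?u (s + h) z * ?\<rho> k z \<partial>lborel)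
          = (\<integral> z. ?u s z * ?\<rho> (Suc k) z - ?u s z * ?\<rho> k z - h * (L (?u s) z * ?\<rho> k z) \<partial>lborel)
          - (\<integral> z. (?u (s + h) z - ?u s z - h * L (?u s) z) * ?\<rho> k z \<partial>lborel)"
          using ints by (simp add: left_diff_distrib mult.assoc del: funpow.simps)
        then show ?thesis
          using 1 2 by (simp add: algebra_simps)
      qed
      \<comment> \<open>Interpolates between the exact value at \<open>k = 0\<close> and the
        discrete one at \<open>k = n\<close>. The subtraction is on naturals, so it is meaningful
        for \<open>k \<le> n\<close>.\<close>
      define a where "a k = (\<integral> z. ?u (real (n - k) * h) z * ?\<rho> k z \<partial>lborel)" for k
      have "\<bar>a n - a 0\<bar> \<le> real n * ((C\<^sub>T + 1) * C\<^sub>2 * M * N * h\<^sup>2)"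
      proof (rule abs_diff_le_sum_steps)
        fix k assume "k < n"
        have nk: "real (n - Suc k) * h + h = real (n - k) * h"
          using \<open>k < n\<close> by (simp add: of_nat_diff algebra_simps)
        have le_T: "real j * h \<le> T" if "j \<le> n" for j
          using that h(1) n by (meson mult_right_mono of_nat_mono order_trans less_imp_le)
        show "\<bar>a (Suc k) - a k\<bar> \<le> (C\<^sub>T + 1) * C\<^sub>2 * M * N * h\<^sup>2"
          using increment[of k "real (n - Suc k) * h"] \<open>k < n\<close> h(1)
            le_T[of "Suc k"] le_T[of "n - k"] nk
          by (simp add: a_def del: funpow.simps)
      qed
      \<comment> \<open>One of the two powers of \<open>h\<close> is spent on the number of
        steps.\<close>
      also have "\<dots> = (real n * h) * ((C\<^sub>T + 1) * C\<^sub>2 * M * N * h)"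
        by (simp add: power2_eq_square mult_ac)
      also have "\<dots> \<le> T * ((C\<^sub>T + 1) * C\<^sub>2 * M * N * h)"
        using n CT C2 M N h(1) by (intro mult_right_mono) auto
      also have "\<dots> \<le> C\<^sub>T' * h * N"
        using CT N(1) h(1) by (simp add: C\<^sub>T'_def algebra_simps)
      finally have "\<bar>a n - a 0\<bar> \<le> C\<^sub>T' * h * N" .
      moreover have "a n = (\<integral> z. f z * ?\<rho> n z \<partial>lborel)"
        by (simp add: a_def u0)
      \<comment> \<open>Duality at time \<open>n * h\<close> moves the backward solution back onto
        \<open>\<rho>\<close>.\<close>
      moreover have "a 0 = (\<integral> z. f z * \<rho> (real n * h) z \<partial>lborel)"
        using duality f n h(1) by (simp add: a_def)
      ultimately have "\<bar>(\<integral> z. f z * ?\<rho> n z \<partial>lborel) - (\<integral> z. f z * \<rho> (real n * h) z \<partial>lborel)\<bar>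
          \<le> C\<^sub>T' * h * N"
        by simp
      then show "ennreal \<bar>(\<integral> z. f z * ?\<rho> n z \<partial>lborel) - (\<integral> z. f z * \<rho> (real n * h) z \<partial>lborel)\<bar>
          \<le> ennreal (C\<^sub>T' * h) * Ck_norm 4 W f"
        using CT CT' h(1) N by (simp add: ennreal_mult[symmetric] ennreal_leI)
    qed
    then show ?thesis
      using hT h' CT' by (intro exI[of _ "min h\<^sub>T h'"] exI[of _ C\<^sub>T']) auto
  qed
  note global = this
  show ?thesis
  proof (intro conjI allI impI)
    fix T :: real assume "0 < T"
    then show "\<exists>h\<^sub>T C\<^sub>T. 0 < h\<^sub>T \<and> h\<^sub>T \<le> min h\<^sub>0 T \<and> 0 < C\<^sub>T \<and> one_step_bound L K W W2 h\<^sub>T C\<^sub>T"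
      \<comment> \<open>The horizon \<open>T\<close> enters only through the cap on the step
        size.\<close>
      using one_step \<open>0 < h\<^sub>0\<close> \<open>0 < C\<close> by (intro exI[of _ "min h\<^sub>0 T"] exI[of _ C]) auto
  qed (elim conjE exE, rule global, assumption+)
qed

end
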